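(* Let $E=\{f:\mathbb{R}\to\mathbb{R}\}$ be endowed with the (Hausdorff, non-metrizable) locally convex topology generated by the seminorms $q_{x_0}(f)=|f(x_0)|$, $x_0\in\mathbb{R}$. Define $\gamma:[0,1]\to E$ by $\gamma(t)(x)=1$ if $x=t$ and $\gamma(t)(x)=0$ if $x\neq t$, for $x\in\mathbb{R}$. Then $\gamma$ is strongly-measurable but not Lusin-measurable.
   Context: $\lambda$ is Lebesgue measure on $[0,1]$ and $\mathcal{L}([0,1])$ the Lebesgue $\sigma$-algebra. A function $\gamma:[0,1]\to E$ is Lusin-measurable if for each $\varepsilon>0$ there is a compact $K_\varepsilon\subseteq[0,1]$ with $\lambda([0,1]\setminus K_\varepsilon)\leq\varepsilon$ and $\gamma|_{K_\varepsilon}$ continuous. A function $\beta:[0,1]\to E$ is simple if $\beta=\sum_{i=1}^n y_i\chi_{A_i}$ for some $y_1,\dots,y_n\in E$ and $A_1,\dots,A_n\in\mathcal{L}([0,1])$. A function $\gamma:[0,1]\to E$ is strongly-measurable if it is the pointwise limit almost everywhere of a sequence of simple functions. *)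

theory Defs
  imports "HOL-Analysis.Analysis" "HOL-Library.Function_Algebras"
begin

text \<open>The library has the pointwise additive group structure on functions but not the
  pointwise scalar multiplication.\<close>

instantiation "fun" :: (type, real_vector) real_vector
begin

definition scaleR_fun :: "real \<Rightarrow> ('a \<Rightarrow> 'b) \<Rightarrow> 'a \<Rightarrow> 'b"
  where "scaleR_fun c f = (\<lambda>x. c *\<^sub>R f x)"

instance
  by standard (simp_all add: scaleR_fun_def fun_eq_iff scaleR_add_left scaleR_add_right)

end

text \<open>The whole space is added to the subbasis only to cover the case of an empty family.\<close>

definition seminorm_topology :: "('e::real_vector \<Rightarrow> real) set \<Rightarrow> 'e topology"
  where "seminorm_topology Q =
    topology_generated_by (insert UNIV {{g. q (g - f) < r} | q f r. q \<in> Q \<and> r > 0})"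

text \<open>Maps on the unit interval are total functions on \<open>real\<close> of which only the values
  on \<open>{0..1}\<close> matter.\<close>

definition Lusin_measurable :: "'e topology \<Rightarrow> (real \<Rightarrow> 'e) \<Rightarrow> bool"
  where "Lusin_measurable T \<gamma> \<longleftrightarrow>
    (\<forall>\<epsilon>>0. \<exists>K. compact K \<and> K \<subseteq> {0..1} \<and>
       emeasure (lebesgue_on {0..1}) ({0..1} - K) \<le> ennreal \<epsilon> \<and>
       continuous_map (top_of_set K) T \<gamma>)"

definition simple_map :: "(real \<Rightarrow> 'e::real_vector) \<Rightarrow> bool"
  where "simple_map \<beta> \<longleftrightarrow>
    (\<exists>(n::nat) y A. (\<forall>i\<in>{1..n}. A i \<in> sets (lebesgue_on {0..1})) \<and>
       (\<forall>t\<in>{0..1}. \<beta> t = (\<Sum>i=1..n. indicat_real (A i) t *\<^sub>R y i)))"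

definition strongly_measurable :: "'e::real_vector topology \<Rightarrow> (real \<Rightarrow> 'e) \<Rightarrow> bool"
  where "strongly_measurable T \<gamma> \<longleftrightarrow>
    (\<exists>\<beta>::nat \<Rightarrow> real \<Rightarrow> 'e. (\<forall>n. simple_map (\<beta> n)) \<and>
       (AE t in lebesgue_on {0..1}. limitin T (\<lambda>n. \<beta> n t) (\<gamma> t) sequentially))"

definition eval_seminorm :: "real \<Rightarrow> (real \<Rightarrow> real) \<Rightarrow> real"
  where "eval_seminorm x\<^sub>0 f = \<bar>f x\<^sub>0\<bar>"

definition pointwise_topology :: "(real \<Rightarrow> real) topology"
  where "pointwise_topology = seminorm_topology (range eval_seminorm)"

definition point_mass :: "real \<Rightarrow> real \<Rightarrow> real"
  where "point_mass t x = (if x = t then 1 else 0)"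

end

theory Submission
  imports Defs
begin

text \<open>The space \<open>E\<close> is the product of copies of the real line indexed by \<real>
  (\<open>pointwise_topology_eq_product\<close>): Hausdorff, but not metrizable because uncountably
  many factors are nontrivial. For strong measurability, replace \<open>point_mass t\<close> by the
  indicator of the cell of length \<open>1/n\<close> containing \<open>t\<close>. As a function of
  \<open>t\<close> this takes finitely many values on [0,1] (\<open>simple_map_same_floor\<close>),
  and any \<open>x\<close> different from \<open>t\<close> eventually leaves the cell of
  \<open>t\<close> (\<open>eventually_floor_neq\<close>), which is all that coordinatewise
  convergence asks for. Lusin measurability fails because the coordinate at \<open>t\<close> singles
  out the parameter \<open>t\<close>: continuity on a compact \<open>K\<close> makes every point of
  \<open>K\<close> isolated, so \<open>K\<close> is finite
  (\<open>finite_if_continuous_point_mass\<close>) and hence null.\<close>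

text \<open>Each seminorm ball is the preimage of an interval under one evaluation map, and such
  preimages generate the product topology. Separation, metrizability, limits and continuity can then
  be treated by coordinates.\<close>

lemma pointwise_topology_eq_product:
  "pointwise_topology = product_topology (\<lambda>_. euclidean) UNIV"
proof -
  let ?B = "insert UNIV {{g. q (g - f) < r} | q f r. q \<in> range eval_seminorm \<and> r > 0}"
  have P: "pointwise_topology = topology_generated_by ?B"
    by (simp add: pointwise_topology_def seminorm_topology_def)
  have top: "topspace pointwise_topology = UNIV"
    by (auto simp: P)
  have fine: "continuous_map (product_topology (\<lambda>_. euclidean) UNIV) pointwise_topology id"
    unfolding P
  proof (rule continuous_on_generated_topo)
    fix U assume "U \<in> ?B"
    then consider "U = UNIV"
      | x f r where "U = {g. eval_seminorm x (g - f) < r}"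
      by auto
    then show "openin (product_topology (\<lambda>_. euclidean) UNIV)
        (id -` U \<inter> topspace (product_topology (\<lambda>_. euclidean) UNIV))"
    proof cases
      case 1
      then show ?thesis
        using openin_topspace[of "product_topology (\<lambda>_::real. euclidean :: real topology) UNIV"]
        by simp
    next
      case 2
      have "continuous_map (product_topology (\<lambda>_. euclidean) UNIV) euclidean (\<lambda>g::real \<Rightarrow> real. g x)"
        by (rule continuous_map_product_projection) simp
      from openin_continuous_map_preimage[OF this, of "ball (f x) r"]
      show ?thesis
        by (simp add: 2 eval_seminorm_def dist_real_def abs_minus_commute PiE_UNIV_domain)
    qed
  qed auto
  have coarse: "continuous_map pointwise_topology (product_topology (\<lambda>_. euclidean) UNIV) id"
    unfolding continuous_map_componentwise_UNIV
  proof
    fix x :: real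
    show "continuous_map pointwise_topology euclidean (\<lambda>g. id g x)"
      unfolding continuous_map
    proof (intro allI conjI impI)
      fix U :: "real set"
      assume "openin euclidean U"
      then have "open U" by simp
      \<comment> \<open>To cover a given \<open>g\<close>, take the seminorm ball centred at
        \<open>g\<close> itself.\<close>
      have "{g. g x \<in> U} = \<Union>{{g. eval_seminorm x (g - f) < r} | f r. r > 0 \<and> ball (f x) r \<subseteq> U}"
        (is "?L = \<Union>?F")
      proof (intro equalityI subsetI)
        fix g assume "g \<in> ?L"
        then obtain r where "r > 0" "ball (g x) r \<subseteq> U"
          using \<open>open U\<close> by (auto simp: open_contains_ball)
        then show "g \<in> \<Union>?F"
          by (intro UnionI[of "{h. eval_seminorm x (h - g) < r}"]) (auto simp: eval_seminorm_def)
      qed (force simp: eval_seminorm_def dist_real_def abs_minus_commute subset_eq)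
      moreover have "openin pointwise_topology (\<Union>?F)"
        unfolding P by (intro openin_Union ballI topology_generated_by_Basis) blast
      ultimately show "openin pointwise_topology {g \<in> topspace pointwise_topology. id g x \<in> U}"
        by (simp add: top)
    qed auto
  qed
  show ?thesis
    unfolding topology_eq
  proof (intro allI iffI)
    fix S
    show "openin (product_topology (\<lambda>_. euclidean) UNIV) S" if "openin pointwise_topology S"
      using openin_continuous_map_preimage[OF fine that] by simp
    show "openin pointwise_topology S" if "openin (product_topology (\<lambda>_. euclidean) UNIV) S"
      using openin_continuous_map_preimage[OF coarse that] by (simp add: top)
  qed
qed

text \<open>A nonempty metrizable product has at most countably many factors with more than one
  point; here every factor has, and the index set is uncountable.\<close>

lemma not_metrizable_pointwise_topology: "\<not> metrizable_space pointwise_topology"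
proof -
  have "topspace (product_topology (\<lambda>_::real. euclidean :: real topology) UNIV) \<noteq> {}"
    by simp
  moreover have "\<not> UNIV \<subseteq> {a}" for a :: real
    by (metis UNIV_I singletonD subsetD zero_neq_one)
  ultimately show ?thesis
    using uncountable_UNIV_real
    by (auto simp: pointwise_topology_eq_product metrizable_space_product_topology
        simp del: topspace_product_topology)
qed

text \<open>Two reals with equal floors differ by less than 1, whereas the distance from
  \<open>n * s\<close> to \<open>n * t\<close> grows without bound.\<close>

lemma eventually_floor_neq:
  fixes s t :: real
  assumes "s \<noteq> t"
  shows "\<forall>\<^sub>F n in sequentially. \<lfloor>real n * s\<rfloor> \<noteq> \<lfloor>real n * t\<rfloor>"
proof -
  obtain N :: nat where N: "1 < real N * \<bar>s - t\<bar>"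
    using assms reals_Archimedean3[of "\<bar>s - t\<bar>"] by auto
  have "\<lfloor>real n * s\<rfloor> \<noteq> \<lfloor>real n * t\<rfloor>" if "N \<le> n" for n
  proof
    assume eq: "\<lfloor>real n * s\<rfloor> = \<lfloor>real n * t\<rfloor>"
    have "real N * \<bar>s - t\<bar> \<le> real n * \<bar>s - t\<bar>"
      using that by (intro mult_right_mono) auto
    also have "\<dots> = \<bar>real n * s - real n * t\<bar>"
      by (simp add: abs_mult flip: right_diff_distrib)
    also have "\<dots> < 1"
      using eq by linarith
    finally show False using N by simp
  qed
  then show ?thesis
    by (auto simp: eventually_sequentially)
qed

lemma simple_map_same_floor:
  "simple_map (\<lambda>t x. if \<lfloor>real n * x\<rfloor> = \<lfloor>real n * t\<rfloor> then 1 else 0 :: real)"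
  unfolding simple_map_def
proof (intro exI conjI ballI)
  \<comment> \<open>The floors on [0,1] lie in 0..\<open>n\<close>, shifted by one to match indices
    starting at 1. The extra cell \<open>n + 1\<close> catches \<open>t = 1\<close>, and for
    \<open>n = 0\<close> it is the whole interval.\<close>
  let ?A = "\<lambda>i::nat. {t \<in> {0..1}. \<lfloor>real n * t\<rfloor> = int i - 1}"
  let ?y = "\<lambda>(i::nat) x. if \<lfloor>real n * x\<rfloor> = int i - 1 then 1 else 0 :: real"
  show "?A i \<in> sets (lebesgue_on {0..1})" for i
  proof -
    have "?A i = {0..1} \<inter> (\<lambda>t. \<lfloor>real n * t\<rfloor>) -` {int i - 1}" by auto
    moreover have "(\<lambda>t. \<lfloor>real n * t\<rfloor>) -` {int i - 1} \<inter> space borel \<in> sets borel"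
      by (rule measurable_sets[of _ borel "count_space UNIV"]) auto
    ultimately show ?thesis
      by (auto simp: sets_restrict_space)
  qed
  fix t :: real assume t: "t \<in> {0..1}"
  define k where "k = nat (\<lfloor>real n * t\<rfloor> + 1)"
  have k: "\<lfloor>real n * t\<rfloor> = int k - 1"
    using t by (simp add: k_def)
  have "real n * t \<le> real n"
    using t by (simp add: mult_left_le)
  then have "\<lfloor>real n * t\<rfloor> \<le> int n"
    by (simp add: floor_le_iff)
  moreover have "0 \<le> \<lfloor>real n * t\<rfloor>" using t by simp
  ultimately have kn: "k \<in> {1..n + 1}" using k by auto
  \<comment> \<open>The cells are disjoint, so only the one containing \<open>t\<close>
    contributes.\<close>
  have "(\<Sum>i=1..n+1. indicat_real (?A i) t *\<^sub>R ?y i) = (\<Sum>i=1..n+1. if i = k then ?y k else 0)"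
    using t by (intro sum.cong) (auto simp: k indicator_def scaleR_fun_def fun_eq_iff)
  also have "\<dots> = ?y k" using kn by simp
  finally show "(\<lambda>x. if \<lfloor>real n * x\<rfloor> = \<lfloor>real n * t\<rfloor> then 1 else 0 :: real) =
      (\<Sum>i=1..n+1. indicat_real (?A i) t *\<^sub>R ?y i)"
    by (simp add: k)
qed

lemma strongly_measurable_point_mass: "strongly_measurable pointwise_topology point_mass"
  unfolding strongly_measurable_def
proof (intro exI conjI allI)
  let ?\<beta> = "\<lambda>(n::nat) t x. if \<lfloor>real n * x\<rfloor> = \<lfloor>real n * t\<rfloor> then 1 else 0 :: real"
  show "simple_map (?\<beta> n)" for n
    by (rule simple_map_same_floor)
  \<comment> \<open>Convergence holds at every \<open>t\<close>, with no exceptional null set: each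
    coordinate sequence is eventually constant.\<close>
  have "(\<lambda>n. ?\<beta> n t x) \<longlonglongrightarrow> point_mass t x" for t x
  proof (cases "x = t")
    case False
    show ?thesis
      by (rule tendsto_eventually, rule eventually_mono[OF eventually_floor_neq[OF False]])
        (simp add: point_mass_def False)
  qed (simp add: point_mass_def)
  then show "AE t in lebesgue_on {0..1}.
      limitin pointwise_topology (\<lambda>n. ?\<beta> n t) (point_mass t) sequentially"
    by (simp add: pointwise_topology_eq_product limitin_componentwise)
qed

text \<open>For \<open>t \<in> K\<close>, the open set \<open>{f. f t > 0}\<close> pulls back to \<open>{t}\<close>, so \<open>K\<close> is discrete.\<close>

lemma finite_if_continuous_point_mass:
  assumes "compact K" and cont: "continuous_map (top_of_set K) pointwise_topology point_mass"
  shows "finite K"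
proof -
  have "openin (top_of_set K) {t}" if "t \<in> K" for t
  proof -
    have "continuous_map (top_of_set K) euclidean (\<lambda>s. point_mass s t)"
      using cont unfolding pointwise_topology_eq_product continuous_map_componentwise_UNIV by blast
    from openin_continuous_map_preimage[OF this, of "{0<..}"]
    have "openin (top_of_set K) {s \<in> K. point_mass s t > 0}" by simp
    also have "{s \<in> K. point_mass s t > 0} = {t}"
      using that by (auto simp: point_mass_def split: if_splits)
    finally show ?thesis .
  qed
  then have "discrete_topology K = top_of_set K"
    by (simp add: discrete_topology_unique)
  then show ?thesis
    using assms(1) by (metis compact_space_discrete_topology compact_space_subtopology
        compactin_euclidean_iff)
qed

text \<open>Removing a finite \<open>K\<close> from [0,1] leaves measure 1, so any tolerance below 1
  gives a contradiction; 1/2 is chosen.\<close>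

lemma not_Lusin_measurable_point_mass: "\<not> Lusin_measurable pointwise_topology point_mass"
proof
  assume "Lusin_measurable pointwise_topology point_mass"
  then have "\<exists>K. compact K \<and> K \<subseteq> {0..1} \<and>
       emeasure (lebesgue_on {0..1}) ({0..1} - K) \<le> ennreal (1/2) \<and>
       continuous_map (top_of_set K) pointwise_topology point_mass"
    unfolding Lusin_measurable_def by (metis half_gt_zero zero_less_one)
  then obtain K where K: "compact K" "K \<subseteq> {0..1}"
      "emeasure (lebesgue_on {0..1}) ({0..1} - K) \<le> ennreal (1/2)"
      "continuous_map (top_of_set K) pointwise_topology point_mass"
    by blast
  then have "finite K"
    by (simp add: finite_if_continuous_point_mass)
  \<comment> \<open>A finite \<open>K\<close> is closed, so the difference is a Borel set, on which
    \<open>lebesgue\<close> and \<open>lborel\<close> agree.\<close>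
  have "emeasure (lebesgue_on {0..1}) ({0..1} - K) = emeasure lborel ({0..1} - K)"
    using \<open>finite K\<close> by (simp add: emeasure_restrict_space finite_imp_closed)
  also have "\<dots> = emeasure lborel {0..1::real}"
    using \<open>finite K\<close> by (intro emeasure_Diff_null_set finite_imp_null_set_lborel) auto
  also have "\<dots> = ennreal 1" by simp
  finally have "ennreal 1 \<le> ennreal (1/2)"
    using K(3) by simp
  then show False
    by (subst (asm) ennreal_le_iff) auto
qed

theorem mainTheorem7:
  shows "Hausdorff_space pointwise_topology \<and> \<not> metrizable_space pointwise_topology \<and>
    strongly_measurable pointwise_topology point_mass \<and>
    \<not> Lusin_measurable pointwise_topology point_mass"
  using not_metrizable_pointwise_topology strongly_measurable_point_mass
    not_Lusin_measurable_point_mass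
  by (auto simp: pointwise_topology_eq_product Hausdorff_space_product_topology)

end
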